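(* Let $g(d)$ denote the smallest integer such that for every finite set $S\subset\mathbb{R}^d$ there is a subset $P\subseteq S$ with $|P|\le g(d)$ such that every $s\in S$ lies in $box(p,q)$ for some $p,q\in P$. Then $g(d)=O\!\left(2^{2^{d-1}}\,d\log d\right)$.
   Context: For $p,q\in\mathbb{R}^d$, $box(p,q)=\{x\in\mathbb{R}^d : \min(p_i,q_i)\le x_i\le \max(p_i,q_i)\text{ for all } i\}$ is the smallest closed axis-parallel box containing $p$ and $q$. *)

theory Defs
  imports Complex_Main "HOL-Library.FuncSet" "HOL-Library.Landau_Symbols"
begin

text \<open>
  The dimension varies inside the statement, so a point of $d$-space is a function on the index
  set \<open>{..<d}\<close>, made unique outside it by extensionality.
\<close>

definition Rn :: "nat \<Rightarrow> (nat \<Rightarrow> real) set" where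
  "Rn d = {..<d} \<rightarrow>\<^sub>E UNIV"

definition axis_box :: "nat \<Rightarrow> (nat \<Rightarrow> real) \<Rightarrow> (nat \<Rightarrow> real) \<Rightarrow> (nat \<Rightarrow> real) set" where
  "axis_box d p q = {x \<in> Rn d. \<forall>i<d. min (p i) (q i) \<le> x i \<and> x i \<le> max (p i) (q i)}"

definition box_cover_bound :: "nat \<Rightarrow> nat \<Rightarrow> bool" where
  "box_cover_bound d n \<longleftrightarrow>
     (\<forall>S. finite S \<and> S \<subseteq> Rn d \<longrightarrow>
        (\<exists>P\<subseteq>S. card P \<le> n \<and> (\<forall>s\<in>S. \<exists>p\<in>P. \<exists>q\<in>P. s \<in> axis_box d p q)))"

text \<open>
  The value is meaningful only if some bound exists, as \<open>LEAST\<close> is unspecified otherwise;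
  results about it should therefore be accompanied by this existence claim.
\<close>

definition box_cover_number :: "nat \<Rightarrow> nat" where
  "box_cover_number d = (LEAST n. box_cover_bound d n)"

end

theory Submission
  imports Defs "HOL-Real_Asymp.Real_Asymp"
begin

text \<open>
  Pair up the \<open>2 ^ d\<close> closed orthants with their antipodes and choose one orthant from each pair.
  The relation ``\<open>x\<close> lies in a chosen orthant with apex \<open>s\<close>'' is total, like a tournament,
  so some probability distribution gives every in-neighbourhood weight at least \<open>1/4\<close>. As \<open>n\<close> points
  are cut by in-neighbourhoods in at most \<open>(n + 1) ^ (2 * d)\<close> ways, an \<open>\<epsilon>\<close>-net argument provides a
  dominating set of size \<open>O(d log d)\<close>. The union of these sets over all \<open>2 ^ 2 ^ (d - 1)\<close> choices
  works: if no box spanned by it contains \<open>s\<close>, then in each antipodal pair one orthant at \<open>s\<close>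
  misses it, contradicting domination for the choice of these orthants.
\<close>

section \<open>Fractional domination in total relations\<close>

text \<open>Averaging: draw \<open>v\<close> with probability proportional to \<open>u\<close>. By
  totality every pair \<open>(v, s)\<close> or its reversal contributes, so the expected dominated
  weight is at least half of the total. If every \<open>v\<close> fell short, summing the shortfalls
  with weights \<open>u v\<close> would contradict this.\<close>

lemma half_weight_dominator:
  fixes u :: "'a \<Rightarrow> real"
  assumes fin: "finite S" and ne: "S \<noteq> {}"
    and total: "\<And>x y. x \<in> S \<Longrightarrow> y \<in> S \<Longrightarrow> R x y \<or> R y x"
    and pos: "\<And>s. s \<in> S \<Longrightarrow> u s > 0"
  shows "\<exists>v\<in>S. sum u S \<le> 2 * (\<Sum>s\<in>S. of_bool (R v s) * u s)"
proof (rule ccontr)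
  assume "\<not> ?thesis"
  then have less: "2 * (\<Sum>s\<in>S. of_bool (R v s) * u s) < sum u S" if "v \<in> S" for v
    using that by force
  let ?a = "\<lambda>v s. of_bool (R v s) :: real"
  have "sum u S * sum u S = (\<Sum>v\<in>S. \<Sum>s\<in>S. u v * u s)"
    by (simp add: sum_product)
  also have "\<dots> \<le> (\<Sum>v\<in>S. \<Sum>s\<in>S. u v * u s * (?a v s + ?a s v))"
  proof (intro sum_mono)
    fix v s assume "v \<in> S" "s \<in> S"
    then have "u v * u s > 0" "1 \<le> ?a v s + ?a s v"
      using pos total[of v s] by auto
    then show "u v * u s \<le> u v * u s * (?a v s + ?a s v)"
      by (metis mult.right_neutral mult_left_mono less_imp_le)
  qed
  also have "\<dots> = (\<Sum>v\<in>S. \<Sum>s\<in>S. u v * (?a v s * u s)) + (\<Sum>v\<in>S. \<Sum>s\<in>S. u s * (?a s v * u v))"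
    by (simp add: sum.distrib algebra_simps)
  also have "(\<Sum>v\<in>S. \<Sum>s\<in>S. u s * (?a s v * u v)) = (\<Sum>v\<in>S. \<Sum>s\<in>S. u v * (?a v s * u s))"
    by (rule sum.swap)
  also have "(\<Sum>v\<in>S. \<Sum>s\<in>S. u v * (?a v s * u s)) + (\<Sum>v\<in>S. \<Sum>s\<in>S. u v * (?a v s * u s))
      = (\<Sum>v\<in>S. u v * (2 * (\<Sum>s\<in>S. ?a v s * u s)))"
    by (simp add: sum_distrib_left sum.distrib[symmetric] mult_ac)
  also have "\<dots> < (\<Sum>v\<in>S. u v * sum u S)"
    using fin ne less pos by (intro sum_strict_mono mult_strict_left_mono) auto
  also have "\<dots> = sum u S * sum u S"
    by (simp add: sum_distrib_right)
  finally show False by simp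
qed

text \<open>
  Each round selects a vertex dominating half of the current weight and halves the weight of
  everything it dominates, so the total weight shrinks by a factor \<open>3/4\<close>.
\<close>

lemma multiplicative_weights_count:
  assumes fin: "finite S" and ne: "S \<noteq> {}"
    and total: "\<And>x y. x \<in> S \<Longrightarrow> y \<in> S \<Longrightarrow> R x y \<or> R y x"
  shows "\<exists>c::'a \<Rightarrow> nat. sum c S = N \<and>
    (\<Sum>s\<in>S. (1/2::real) ^ (\<Sum>x\<in>S. of_bool (R x s) * c x)) \<le> card S * (3/4) ^ N"
proof (induction N)
  case 0
  show ?case by (rule exI[of _ "\<lambda>_. 0"]) simp
next
  case (Suc N)
  then obtain c :: "'a \<Rightarrow> nat" where c: "sum c S = N"
    and le: "(\<Sum>s\<in>S. (1/2::real) ^ (\<Sum>x\<in>S. of_bool (R x s) * c x)) \<le> card S * (3/4) ^ N"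
    by blast
  define u where "u s = (1/2::real) ^ (\<Sum>x\<in>S. of_bool (R x s) * c x)" for s
  obtain v where v: "v \<in> S" "sum u S \<le> 2 * (\<Sum>s\<in>S. of_bool (R v s) * u s)"
    using half_weight_dominator[of S R u] fin ne total by (auto simp: u_def)
  define c' where "c' x = c x + of_bool (x = v)" for x
  have sum_c': "sum c' S = Suc N"
    using c v fin by (simp add: c'_def sum.distrib of_bool_def)
  have "(\<Sum>x\<in>S. of_bool (R x s) * c' x) = (\<Sum>x\<in>S. of_bool (R x s) * c x) + of_bool (R v s)" for s
  proof -
    have "(\<Sum>x\<in>S. of_bool (R x s) * of_bool (x = v)) = (\<Sum>x\<in>S. if x = v then of_bool (R v s) else (0::nat))"
      by (intro sum.cong) auto
    then show ?thesis
      using v fin by (simp add: c'_def sum.distrib distrib_left)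
  qed
  then have "(\<Sum>s\<in>S. (1/2::real) ^ (\<Sum>x\<in>S. of_bool (R x s) * c' x)) = (\<Sum>s\<in>S. u s - (of_bool (R v s) * u s) / 2)"
    by (intro sum.cong) (auto simp: u_def)
  also have "\<dots> = sum u S - (\<Sum>s\<in>S. of_bool (R v s) * u s) / 2"
    by (simp add: sum_subtractf sum_divide_distrib)
  also have "\<dots> \<le> (3/4) * sum u S"
    using v by simp
  also have "\<dots> \<le> (3/4) * (card S * (3/4) ^ N)"
    using le by (simp add: u_def)
  finally have "(\<Sum>s\<in>S. (1/2::real) ^ (\<Sum>x\<in>S. of_bool (R x s) * c' x)) \<le> card S * (3/4) ^ Suc N"
    by simp
  with sum_c' show ?case by blast
qed

text \<open>The distribution is the frequency with which each vertex is selected in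
  \<open>4 * K\<close> rounds. A point dominated fewer than \<open>K\<close> times would alone keep
  more weight than the total that remains.\<close>

lemma fractional_domination:
  assumes fin: "finite S" and ne: "S \<noteq> {}"
    and total: "\<And>x y. x \<in> S \<Longrightarrow> y \<in> S \<Longrightarrow> R x y \<or> R y x"
  obtains w :: "'a \<Rightarrow> real" where "\<And>x. 0 \<le> w x" "sum w S = 1"
    "\<And>s. s \<in> S \<Longrightarrow> 1/4 \<le> (\<Sum>x\<in>S. of_bool (R x s) * w x)"
proof -
  \<comment> \<open>\<open>128/81\<close> is chosen because (3/4)^4 = 81/256 and 128/81 * 81/256 =
    1/2: four rounds shrink the total by enough to beat one halving.\<close>
  obtain K0 :: nat where K0: "real (card S) < (128/81) ^ K0"
    using real_arch_pow[of "128/81" "card S"] by auto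
  \<comment> \<open>The successor keeps \<open>K\<close> positive, so that division by
    \<open>4 * K\<close> normalises the counts.\<close>
  define K where "K = Suc K0"
  have K: "real (card S) < (128/81) ^ K" 
    using K0 power_increasing[of K0 K "128/81::real"] by (simp add: K_def)
  obtain c :: "'a \<Rightarrow> nat" where c: "sum c S = 4 * K"
    and le: "(\<Sum>s\<in>S. (1/2::real) ^ (\<Sum>x\<in>S. of_bool (R x s) * c x)) \<le> card S * (3/4) ^ (4 * K)"
    using multiplicative_weights_count[of S R "4 * K"] assms by blast
  have large: "K \<le> (\<Sum>x\<in>S. of_bool (R x s) * c x)" if s: "s \<in> S" for s
  proof (rule ccontr)
    assume "\<not> ?thesis"
    then have "(1/2::real) ^ K \<le> (1/2) ^ (\<Sum>x\<in>S. of_bool (R x s) * c x)"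
      by (intro power_decreasing) auto
    also have "\<dots> \<le> (\<Sum>s\<in>S. (1/2::real) ^ (\<Sum>x\<in>S. of_bool (R x s) * c x))"
      using fin s by (intro member_le_sum) auto
    also have "\<dots> \<le> card S * ((3/4) ^ 4) ^ K"
      using le by (simp only: power_mult)
    also have "\<dots> < (128/81) ^ K * ((3/4) ^ 4) ^ K"
      using K by (intro mult_strict_right_mono) auto
    also have "\<dots> = (1/2) ^ K"
      by (simp only: power_mult_distrib[symmetric]) (simp add: field_simps)
    finally show False by simp
  qed
  show thesis
  proof (rule that[of "\<lambda>x. real (c x) / real (4 * K)"])
    show "(\<Sum>x\<in>S. real (c x) / real (4 * K)) = 1"
      unfolding sum_divide_distrib[symmetric] of_nat_sum[symmetric] c by (simp add: K_def)
    fix s assume "s \<in> S"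
    have "(\<Sum>x\<in>S. of_bool (R x s) * (real (c x) / real (4 * K)))
        = real (\<Sum>x\<in>S. of_bool (R x s) * c x) / real (4 * K)"
      by (simp add: sum_divide_distrib)
    moreover have "real K / real (4 * K) \<le> real (\<Sum>x\<in>S. of_bool (R x s) * c x) / real (4 * K)"
      using large[OF \<open>s \<in> S\<close>] by (intro divide_right_mono) (auto simp del: of_nat_sum)
    moreover have "real K / real (4 * K) = 1/4"
      by (simp add: K_def)
    ultimately show "1/4 \<le> (\<Sum>x\<in>S. of_bool (R x s) * (real (c x) / real (4 * K)))"
      by linarith
  qed simp
qed

section \<open>Small nets by double sampling\<close>

text \<open>
  Double sampling: if no \<open>m\<close>-sample \<open>x\<close> is a net, weigh each pair of samples \<open>(x, y)\<close> by
  \<open>2 ^ (number of hits of y)\<close> in a range missed by \<open>x\<close>. The mean is at least \<open>(5/4) ^ m\<close> by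
  independence, while averaging over swaps of \<open>x i\<close> and \<open>y i\<close> bounds it by the number of traces.
\<close>

lemma eps_net:
  fixes w :: "'a \<Rightarrow> real"
  assumes fin: "finite S"
    and w: "\<And>x. 0 \<le> w x" "sum w S = 1"
    and heavy: "\<And>s. s \<in> S \<Longrightarrow> 1/4 \<le> (\<Sum>x\<in>S. of_bool (R x s) * w x)"
    and traces: "\<And>V. V \<subseteq> S \<Longrightarrow> card V \<le> 2 * m \<Longrightarrow> card ((\<lambda>s. {v\<in>V. R v s}) ` S) \<le> k"
    and m: "real k < (5/4) ^ m"
  shows "\<exists>P\<subseteq>S. card P \<le> m \<and> (\<forall>s\<in>S. \<exists>p\<in>P. R p s)"
proof (rule ccontr)
  assume contra: "\<not> ?thesis"
  define X where "X = ({..<m} \<rightarrow>\<^sub>E S)"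
  have finX: "finite X"
    unfolding X_def using fin by (intro finite_PiE) auto
  have "\<exists>s\<in>S. \<forall>i<m. \<not> R (x i) s" if "x \<in> X" for x
  proof -
    have "x ` {..<m} \<subseteq> S" "card (x ` {..<m}) \<le> m"
      using that card_image_le[of "{..<m}" x] by (auto simp: X_def)
    then have "\<not> (\<forall>s\<in>S. \<exists>p\<in>x ` {..<m}. R p s)"
      using contra by metis
    then show ?thesis by auto
  qed
  then obtain f where f: "\<And>x. x \<in> X \<Longrightarrow> f x \<in> S" "\<And>x i. x \<in> X \<Longrightarrow> i < m \<Longrightarrow> \<not> R (x i) (f x)"
    by metis
  define \<mu> where "\<mu> x = (\<Prod>i<m. w (x i))" for x :: "nat \<Rightarrow> 'a"
  have \<mu>0: "0 \<le> \<mu> x" for x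
    by (simp add: \<mu>_def prod_nonneg w)
  have sum\<mu>: "sum \<mu> X = 1"
    unfolding \<mu>_def X_def by (subst prod.swap prod_sum_PiE[symmetric]; simp add: fin w)
  \<comment> \<open>With these factors, \<open>F A x y\<close> is 2 to the number of indices
    \<open>i\<close> with \<open>y i\<close> in \<open>A\<close> if \<open>x\<close> avoids
    \<open>A\<close>, and 0 otherwise.\<close>
  define \<phi> where "\<phi> A a b = of_bool (a \<notin> A) * (1 + of_bool (b \<in> A) :: real)" for A and a b :: 'a
  define F where "F A x y = (\<Prod>i<m. \<phi> A (x i) (y i))" for A and x y :: "nat \<Rightarrow> 'a"
  define V where "V x y = x ` {..<m} \<union> y ` {..<m}" for x y :: "nat \<Rightarrow> 'a"
  define \<T> where "\<T> x y = (\<lambda>s. {v\<in>V x y. R v s}) ` S" for x y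
  define G where "G x y = (\<Sum>A\<in>\<T> x y. F A x y)" for x y
  have \<phi>0: "0 \<le> \<phi> A a b" for A a b by (simp add: \<phi>_def)
  have F0: "0 \<le> F A x y" for A x y by (simp add: F_def prod_nonneg \<phi>0)
  have fin\<T>: "finite (\<T> x y)" for x y by (simp add: \<T>_def fin)
  have card\<T>: "card (\<T> x y) \<le> k" if "x \<in> X" "y \<in> X" for x y
    unfolding \<T>_def
  proof (rule traces)
    show "V x y \<subseteq> S" using that by (auto simp: V_def X_def)
    have "card (V x y) \<le> card (x ` {..<m}) + card (y ` {..<m})"
      unfolding V_def by (rule card_Un_le)
    also have "\<dots> \<le> m + m"
      using card_image_le[of "{..<m}" x] card_image_le[of "{..<m}" y] by (intro add_mono) auto
    finally show "card (V x y) \<le> 2 * m" by simp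
  qed

  have lower: "(5/4) ^ m \<le> (\<Sum>x\<in>X. \<Sum>y\<in>X. \<mu> x * \<mu> y * G x y)"
  proof -
    have "(5/4) ^ m * \<mu> x \<le> (\<Sum>y\<in>X. \<mu> x * \<mu> y * G x y)" if x: "x \<in> X" for x
    proof -
      let ?h = "\<lambda>b. w b * (1 + of_bool (R b (f x)))"
      \<comment> \<open>One draw has mean factor at least 1 + 1/4, since the range of
        \<open>f x\<close> is heavy; independence raises this to the power \<open>m\<close>.\<close>
      have "5/4 \<le> sum w S + (\<Sum>b\<in>S. of_bool (R b (f x)) * w b)"
        using w heavy[OF f(1)[OF x]] by simp
      also have "\<dots> = sum ?h S"
        by (simp add: sum.distrib algebra_simps)
      finally have "(5/4) ^ m \<le> sum ?h S ^ m"
        by (intro power_mono) auto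
      also have "\<dots> = (\<Prod>i<m. sum ?h S)" by simp
      also have "\<dots> = (\<Sum>y\<in>X. \<Prod>i<m. ?h (y i))"
        unfolding X_def by (subst prod_sum_PiE) (simp_all add: fin)
      also have "\<dots> \<le> (\<Sum>y\<in>X. \<mu> y * G x y)"
      proof (rule sum_mono)
        fix y assume y: "y \<in> X"
        \<comment> \<open>The trace of the missed range is just one of the nonnegative terms of
          \<open>G x y\<close>.\<close>
        let ?A = "{v\<in>V x y. R v (f x)}"
        have "(\<Prod>i<m. ?h (y i)) = \<mu> y * F ?A x y"
          unfolding \<mu>_def F_def prod.distrib[symmetric]
          using f(2)[OF x] by (intro prod.cong) (auto simp: \<phi>_def V_def)
        also have "\<dots> \<le> \<mu> y * G x y"
          unfolding G_def using f(1)[OF x]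
          by (intro mult_left_mono \<mu>0 member_le_sum F0 fin\<T>) (auto simp: \<T>_def)
        finally show "(\<Prod>i<m. ?h (y i)) \<le> \<mu> y * G x y" .
      qed
      finally have "(5/4) ^ m * \<mu> x \<le> (\<Sum>y\<in>X. \<mu> y * G x y) * \<mu> x"
        by (intro mult_right_mono \<mu>0)
      then show ?thesis by (simp add: sum_distrib_left sum_distrib_right mult_ac)
    qed
    then have "(\<Sum>x\<in>X. (5/4) ^ m * \<mu> x) \<le> (\<Sum>x\<in>X. \<Sum>y\<in>X. \<mu> x * \<mu> y * G x y)"
      by (rule sum_mono)
    then show ?thesis by (simp add: sum_distrib_left[symmetric] sum\<mu>)
  qed

  \<comment> \<open>Exchanging the coordinates in \<sigma> preserves the product weight and the
    joint support \<open>V\<close>, hence also the set of traces; so the double sum may be averaged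
    over \<sigma> with the traces held fixed.\<close>
  define sw where "sw \<sigma> x y = (\<lambda>i. if i \<in> \<sigma> then y i else x i)" for \<sigma> and x y :: "nat \<Rightarrow> 'a"
  have swX: "sw \<sigma> x y \<in> X" if "x \<in> X" "y \<in> X" for \<sigma> x y
    using that by (auto simp: sw_def X_def PiE_def extensional_def)
  have swsw: "sw \<sigma> (sw \<sigma> x y) (sw \<sigma> y x) = x" for \<sigma> x y
    by (auto simp: sw_def)
  have sw\<mu>: "\<mu> (sw \<sigma> x y) * \<mu> (sw \<sigma> y x) = \<mu> x * \<mu> y" for \<sigma> x y
    unfolding \<mu>_def prod.distrib[symmetric] by (intro prod.cong) (auto simp: sw_def)
  have swV: "V (sw \<sigma> x y) (sw \<sigma> y x) = V x y" for \<sigma> x y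
    by (auto simp: V_def sw_def image_iff)
  have sw\<T>: "\<T> (sw \<sigma> x y) (sw \<sigma> y x) = \<T> x y" for \<sigma> x y
    by (simp add: \<T>_def swV)
  have invariant: "(\<Sum>x\<in>X. \<Sum>y\<in>X. \<mu> x * \<mu> y * G x y)
      = (\<Sum>(x,y)\<in>X\<times>X. \<mu> x * \<mu> y * G (sw \<sigma> x y) (sw \<sigma> y x))" for \<sigma>
    unfolding sum.cartesian_product
    by (rule sum.reindex_bij_witness[of _ "\<lambda>(x,y). (sw \<sigma> x y, sw \<sigma> y x)" "\<lambda>(x,y). (sw \<sigma> x y, sw \<sigma> y x)"])
       (auto simp: swsw swX sw\<mu>)
  \<comment> \<open>The sum over \<sigma> expands a product over \<open>i\<close>. Each factor adds
    both orders of \<open>x i\<close> and \<open>y i\<close>: it is 1 + 1 if neither lies in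
    \<open>A\<close>, 2 + 0 if exactly one does, and 0 if both do. Thus each trace averages at most
    1 over the \<open>2 ^ m\<close> swaps.\<close>
  have swF: "(\<Sum>\<sigma>\<in>Pow {..<m}. F A (sw \<sigma> x y) (sw \<sigma> y x)) \<le> 2 ^ m" for A x y
  proof -
    have "(\<Sum>\<sigma>\<in>Pow {..<m}. F A (sw \<sigma> x y) (sw \<sigma> y x))
        = (\<Sum>\<sigma>\<in>Pow {..<m}. (\<Prod>i\<in>\<sigma>. \<phi> A (y i) (x i)) * (\<Prod>i\<in>{..<m}-\<sigma>. \<phi> A (x i) (y i)))"
    proof (rule sum.cong)
      fix \<sigma> assume "\<sigma> \<in> Pow {..<m}"
      then have "F A (sw \<sigma> x y) (sw \<sigma> y x)
          = (\<Prod>i\<in>{..<m}-\<sigma>. \<phi> A (sw \<sigma> x y i) (sw \<sigma> y x i)) * (\<Prod>i\<in>\<sigma>. \<phi> A (sw \<sigma> x y i) (sw \<sigma> y x i))"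
        unfolding F_def by (intro prod.subset_diff) auto
      also have "\<dots> = (\<Prod>i\<in>{..<m}-\<sigma>. \<phi> A (x i) (y i)) * (\<Prod>i\<in>\<sigma>. \<phi> A (y i) (x i))"
        by (simp add: sw_def)
      finally show "F A (sw \<sigma> x y) (sw \<sigma> y x)
          = (\<Prod>i\<in>\<sigma>. \<phi> A (y i) (x i)) * (\<Prod>i\<in>{..<m}-\<sigma>. \<phi> A (x i) (y i))" by simp
    qed simp
    also have "\<dots> = (\<Prod>i<m. \<phi> A (y i) (x i) + \<phi> A (x i) (y i))"
      by (rule prod_add[symmetric]) simp
    also have "\<dots> \<le> (\<Prod>i<m. 2)"
      by (intro prod_mono) (auto simp: \<phi>_def)
    finally show ?thesis by simp
  qed
  have "2 ^ m * (\<Sum>x\<in>X. \<Sum>y\<in>X. \<mu> x * \<mu> y * G x y)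
      = (\<Sum>\<sigma>\<in>Pow {..<m}. \<Sum>(x,y)\<in>X\<times>X. \<mu> x * \<mu> y * G (sw \<sigma> x y) (sw \<sigma> y x))"
    by (subst invariant[symmetric]) (simp add: card_Pow)
  also have "\<dots> = (\<Sum>(x,y)\<in>X\<times>X. \<mu> x * \<mu> y * (\<Sum>\<sigma>\<in>Pow {..<m}. G (sw \<sigma> x y) (sw \<sigma> y x)))"
    by (subst sum.swap) (simp add: sum_distrib_left case_prod_beta)
  also have "\<dots> = (\<Sum>(x,y)\<in>X\<times>X. \<mu> x * \<mu> y * (\<Sum>A\<in>\<T> x y. \<Sum>\<sigma>\<in>Pow {..<m}. F A (sw \<sigma> x y) (sw \<sigma> y x)))"
    unfolding G_def sw\<T> by (subst sum.swap) simp
  also have "\<dots> \<le> (\<Sum>(x,y)\<in>X\<times>X. \<mu> x * \<mu> y * (k * 2 ^ m))"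
  proof (rule sum_mono, clarify)
    fix x y assume xy: "x \<in> X" "y \<in> X"
    have "(\<Sum>A\<in>\<T> x y. \<Sum>\<sigma>\<in>Pow {..<m}. F A (sw \<sigma> x y) (sw \<sigma> y x)) \<le> (\<Sum>A\<in>\<T> x y. 2 ^ m)"
      by (intro sum_mono swF)
    also have "\<dots> \<le> k * 2 ^ m"
      using card\<T>[OF xy] by simp
    finally show "\<mu> x * \<mu> y * (\<Sum>A\<in>\<T> x y. \<Sum>\<sigma>\<in>Pow {..<m}. F A (sw \<sigma> x y) (sw \<sigma> y x)) \<le> \<mu> x * \<mu> y * (k * 2 ^ m)"
      by (intro mult_left_mono mult_nonneg_nonneg \<mu>0)
  qed
  also have "\<dots> = (sum \<mu> X * sum \<mu> X) * (k * 2 ^ m)"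
    by (subst sum_product) (simp only: sum_distrib_right sum.cartesian_product[symmetric])
  finally have "(\<Sum>x\<in>X. \<Sum>y\<in>X. \<mu> x * \<mu> y * G x y) \<le> k"
    by (simp add: sum\<mu>)
  with lower m show False by linarith
qed

section \<open>Orthant relations and their traces\<close>

text \<open>The orthants are closed: a tie satisfies either sign, so the relation is reflexive, as
  totality requires.\<close>

definition in_orthant :: "nat \<Rightarrow> nat set \<Rightarrow> (nat \<Rightarrow> real) \<Rightarrow> (nat \<Rightarrow> real) \<Rightarrow> bool" where
  "in_orthant d \<tau> x s \<longleftrightarrow> (\<forall>i<d. if i \<in> \<tau> then s i \<le> x i else x i \<le> s i)"

text \<open>
  The sets \<open>\<tau> \<subseteq> {..<d - 1}\<close> represent the antipodal pairs of orthants, and swapping the arguments of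
  \<open>in_orthant\<close> passes to the antipode; thus \<open>\<epsilon>\<close> encodes a choice from each pair.
\<close>

definition orient :: "nat \<Rightarrow> nat set set \<Rightarrow> (nat \<Rightarrow> real) \<Rightarrow> (nat \<Rightarrow> real) \<Rightarrow> bool" where
  "orient d \<epsilon> x s \<longleftrightarrow>
     (\<exists>\<tau>\<in>Pow {..<d - 1}. if \<tau> \<in> \<epsilon> then in_orthant d \<tau> x s else in_orthant d \<tau> s x)"

text \<open>The last coordinate decides which point serves as apex, and the comparisons in the other
  coordinates give \<tau>.\<close>

lemma in_orthant_total:
  "\<exists>\<tau>\<in>Pow {..<d - 1}. in_orthant d \<tau> x s \<or> in_orthant d \<tau> s x"
proof -
  have *: "\<exists>\<tau>\<in>Pow {..<d - 1}. in_orthant d \<tau> x s" if "x (d - 1) \<le> s (d - 1)" for x s :: "nat \<Rightarrow> real"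
  proof (rule bexI[of _ "{i. i < d - 1 \<and> s i \<le> x i}"])
    have "i = d - 1" if "i < d" "\<not> i < d - 1" for i
      using that by linarith
    then show "in_orthant d {i. i < d - 1 \<and> s i \<le> x i} x s"
      using that by (auto simp: in_orthant_def)
  qed auto
  show ?thesis
    using *[of x s] *[of s x] by (meson linear)
qed

lemma orient_total: "orient d \<epsilon> x s \<or> orient d \<epsilon> s x"
  using in_orthant_total[of d x s] unfolding orient_def by metis

lemma in_orthant_cong:
  assumes "\<And>i. i < d \<Longrightarrow> (v i < s i \<longleftrightarrow> v i < t i) \<and> (v i \<le> s i \<longleftrightarrow> v i \<le> t i)"
  shows "in_orthant d \<tau> v s \<longleftrightarrow> in_orthant d \<tau> v t" "in_orthant d \<tau> s v \<longleftrightarrow> in_orthant d \<tau> t v"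
  using assms unfolding in_orthant_def by (meson not_le)+

text \<open>A trace depends only on the position of \<open>s\<close> among the points of
  \<open>V\<close> in each coordinate, recorded by two counts between 0 and
  \<open>n\<close>.\<close>

lemma orient_traces:
  assumes "finite V" "card V \<le> n"
  shows "card ((\<lambda>s. {v\<in>V. orient d \<epsilon> v s}) ` S) \<le> (n + 1) ^ (2 * d)"
proof -
  define \<kappa> where "\<kappa> s = (\<lambda>i\<in>{..<d}. (card {v\<in>V. v i < s i}, card {v\<in>V. v i \<le> s i}))"
    for s :: "nat \<Rightarrow> real"
  let ?tr = "\<lambda>s. {v\<in>V. orient d \<epsilon> v s}"
  let ?K = "{..<d} \<rightarrow>\<^sub>E ({..n} \<times> {..n})"
  have card_eqD: "A = B" if "card A = card B" "A \<subseteq> B \<or> B \<subseteq> A" "A \<subseteq> V" "B \<subseteq> V" for A B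
    using that assms by (metis card_subset_eq finite_subset)
  have same: "?tr s = ?tr t" if eq: "\<kappa> s = \<kappa> t" for s t
  proof -
    have "(v i < s i \<longleftrightarrow> v i < t i) \<and> (v i \<le> s i \<longleftrightarrow> v i \<le> t i)" if "i < d" "v \<in> V" for v i
    proof -
      have "card {v\<in>V. v i < s i} = card {v\<in>V. v i < t i}" "card {v\<in>V. v i \<le> s i} = card {v\<in>V. v i \<le> t i}"
        using fun_cong[OF eq, of i] that by (auto simp: \<kappa>_def)
      \<comment> \<open>Initial segments of one coordinate are nested, so equal cardinality forces
        equality.\<close>
      then have "{v\<in>V. v i < s i} = {v\<in>V. v i < t i}" "{v\<in>V. v i \<le> s i} = {v\<in>V. v i \<le> t i}"
        using linear[of "s i" "t i"] by (intro card_eqD; force)+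
      then show ?thesis using that by blast
    qed
    then have "orient d \<epsilon> v s \<longleftrightarrow> orient d \<epsilon> v t" if "v \<in> V" for v
      using in_orthant_cong[of d v s t] that unfolding orient_def by auto
    then show ?thesis by blast
  qed
  have sub: "\<kappa> ` S \<subseteq> ?K"
  proof -
    have "card {v\<in>V. Q v} \<le> n" for Q
      using assms card_mono[of V "{v\<in>V. Q v}"] by fastforce
    then show ?thesis by (auto simp: \<kappa>_def split: if_splits)
  qed
  have finK: "finite ?K" by (intro finite_PiE) auto
  have "?tr s = ?tr (inv_into S \<kappa> (\<kappa> s))" if "s \<in> S" for s
    using that by (intro same) (simp add: f_inv_into_f)
  then have "?tr ` S \<subseteq> (\<lambda>c. ?tr (inv_into S \<kappa> c)) ` \<kappa> ` S"
    by blast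
  then have "card (?tr ` S) \<le> card (\<kappa> ` S)"
    using finK sub by (meson card_image_le card_mono finite_imageI finite_subset order_trans)
  also have "\<dots> \<le> card ?K"
    using finK sub by (rule card_mono)
  also have "\<dots> = (n + 1) ^ (2 * d)"
    by (simp add: card_PiE power_mult power2_eq_square)
  finally show ?thesis .
qed

section \<open>Dominating sets and the covering bound\<close>

lemma orient_dominating_set:
  assumes "finite S" and m: "real ((2 * m + 1) ^ (2 * d)) < (5/4) ^ m"
  shows "\<exists>P\<subseteq>S. card P \<le> m \<and> (\<forall>s\<in>S. \<exists>p\<in>P. orient d \<epsilon> p s)"
proof (cases "S = {}")
  case False
  obtain w :: "(nat \<Rightarrow> real) \<Rightarrow> real" where w: "\<And>x. 0 \<le> w x" "sum w S = 1"
    "\<And>s. s \<in> S \<Longrightarrow> 1/4 \<le> (\<Sum>x\<in>S. of_bool (orient d \<epsilon> x s) * w x)"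
    using fractional_domination[of S "orient d \<epsilon>"] assms(1) False orient_total by blast
  show ?thesis
    using orient_traces finite_subset[OF _ assms(1)] by (intro eps_net[OF assms(1) w _ m]) blast+
qed auto

lemma box_cover_boundI:
  assumes m: "real ((2 * m + 1) ^ (2 * d)) < (5/4) ^ m"
  shows "box_cover_bound d (2 ^ 2 ^ (d - 1) * m)"
  unfolding box_cover_bound_def
proof (intro allI impI, elim conjE)
  fix S :: "(nat \<Rightarrow> real) set"
  assume S: "finite S" "S \<subseteq> Rn d"
  let ?H = "Pow {..<d - 1}"
  obtain D where D: "\<And>\<epsilon>. D \<epsilon> \<subseteq> S" "\<And>\<epsilon>. card (D \<epsilon>) \<le> m"
    "\<And>\<epsilon> s. s \<in> S \<Longrightarrow> \<exists>p\<in>D \<epsilon>. orient d \<epsilon> p s"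
    using orient_dominating_set[OF S(1) m] by metis
  define P where "P = (\<Union>\<epsilon>\<in>Pow ?H. D \<epsilon>)"
  have "card P \<le> (\<Sum>\<epsilon>\<in>Pow ?H. card (D \<epsilon>))"
    unfolding P_def by (intro card_UN_le) auto
  also have "\<dots> \<le> (\<Sum>\<epsilon>\<in>Pow ?H. m)"
    by (intro sum_mono D)
  also have "\<dots> = 2 ^ 2 ^ (d - 1) * m"
    by (simp add: card_Pow)
  finally have card: "card P \<le> 2 ^ 2 ^ (d - 1) * m" .
  have "\<exists>p\<in>P. \<exists>q\<in>P. s \<in> axis_box d p q" if s: "s \<in> S" for s
  proof -
    \<comment> \<open>The adversarial choice: whenever the orthant \<tau> at \<open>s\<close> misses
      \<open>P\<close>, that orthant is the one chosen from its pair. Domination by \<open>p\<close>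
      must then use a pair with \<tau> outside \<epsilon>, whose orthant contains some
      \<open>q\<close>, while \<open>p\<close> lies in the antipodal one.\<close>
    define \<epsilon> where "\<epsilon> = {\<tau>\<in>?H. \<not> (\<exists>p\<in>P. in_orthant d \<tau> p s)}"
    obtain p where p: "p \<in> D \<epsilon>" "orient d \<epsilon> p s"
      using D(3)[OF s] by blast
    have pP: "p \<in> P" using p(1) by (auto simp: P_def \<epsilon>_def)
    obtain \<tau> where \<tau>: "\<tau> \<in> ?H" "if \<tau> \<in> \<epsilon> then in_orthant d \<tau> p s else in_orthant d \<tau> s p"
      using p(2) unfolding orient_def by blast
    have "\<tau> \<notin> \<epsilon>"
      using \<tau> pP unfolding \<epsilon>_def by (metis (mono_tags, lifting) mem_Collect_eq)
    then obtain q where q: "q \<in> P" "in_orthant d \<tau> q s"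
      using \<tau>(1) by (auto simp: \<epsilon>_def)
    have "in_orthant d \<tau> s p"
      using \<tau>(2) \<open>\<tau> \<notin> \<epsilon>\<close> by simp
    then have "min (p i) (q i) \<le> s i \<and> s i \<le> max (p i) (q i)" if "i < d" for i
      using q(2) that unfolding in_orthant_def by (smt (verit))
    then have "s \<in> axis_box d p q"
      using s S(2) by (auto simp: axis_box_def)
    then show ?thesis using pP q(1) by blast
  qed
  moreover have "P \<subseteq> S" using D(1) by (auto simp: P_def)
  ultimately show "\<exists>P\<subseteq>S. card P \<le> 2 ^ 2 ^ (d - 1) * m \<and> (\<forall>s\<in>S. \<exists>p\<in>P. \<exists>q\<in>P. s \<in> axis_box d p q)"
    using card by blast
qed

section \<open>Existence and asymptotics of the sample size\<close>

text \<open>For fixed \<open>d\<close> the exponential outgrows the polynomial trace count, so some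
  \<open>m\<close> qualifies.\<close>

lemma box_cover_bound_exists: "\<exists>n. box_cover_bound d n"
proof -
  have "eventually (\<lambda>m::nat. (2 * real m + 1) ^ (2 * d) < (5/4) ^ m) sequentially"
    by real_asymp
  then obtain m :: nat where "(2 * real m + 1) ^ (2 * d) < (5/4) ^ m"
    by (auto simp: eventually_at_top_linorder)
  then have "real ((2 * m + 1) ^ (2 * d)) < (5/4) ^ m"
    by (simp add: algebra_simps)
  then show ?thesis using box_cover_boundI by blast
qed

lemma net_size_condition:
  assumes "2 * real d * ln (2 * real m + 1) < real m / 5"
  shows "real ((2 * m + 1) ^ (2 * d)) < (5/4) ^ m"
proof -
  \<comment> \<open>This is ln x \<le> x - 1 at x = 4/5, negated.\<close>
  have "1 / 5 \<le> ln (5/4 :: real)"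
    using ln_le_minus_one[of "4/5::real"] ln_div[of 1 "5/4::real"] by simp
  then have "real m / 5 \<le> real m * ln (5/4)"
    using mult_left_mono[of "1/5" "ln (5/4::real)" "real m"] by simp
  then have "real (2 * d) * ln (2 * real m + 1) < real m * ln (5/4)"
    using assms by simp
  then have "ln ((2 * real m + 1) ^ (2 * d)) < ln ((5/4) ^ m)"
    by (subst (1 2) ln_realpow) auto
  then show ?thesis by (simp add: add.commute)
qed

theorem theorem1p7:
  "(\<forall>d\<ge>1. \<exists>n. box_cover_bound d n) \<and>
   (\<lambda>d. real (box_cover_number d)) \<in> O(\<lambda>d. 2 ^ (2 ^ (d - 1)) * real d * ln (real d))"
proof
  show "\<forall>d\<ge>1. \<exists>n. box_cover_bound d n"
    using box_cover_bound_exists by blast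
  \<comment> \<open>The condition asks for m > 10 d ln(2m + 1). As ln(2m + 1) is asymptotic to ln d
    here, any constant above 10 would do; 20 leaves room.\<close>
  define m where "m d = nat \<lceil>20 * real d * ln (real d)\<rceil>" for d :: nat
  have "eventually (\<lambda>d::nat. 2 * real d * ln (2 * (20 * real d * ln (real d) + 1) + 1)
      < 20 * real d * ln (real d) / 5) sequentially"
    by real_asymp
  \<comment> \<open>This absorbs the rounding error of at most 1, doubling 20 to the final constant
    40.\<close>
  moreover have "eventually (\<lambda>d::nat. 20 * real d * ln (real d) \<ge> 1) sequentially"
    by real_asymp
  ultimately have "eventually (\<lambda>d. real (box_cover_number d)
      \<le> 40 * (2 ^ (2 ^ (d - 1)) * real d * ln (real d))) sequentially"
  proof eventually_elim
    case (elim d)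
    have m: "20 * real d * ln (real d) \<le> real (m d)" "real (m d) \<le> 20 * real d * ln (real d) + 1"
      unfolding m_def using elim(2) by linarith+
    have "2 * real d * ln (2 * real (m d) + 1)
        \<le> 2 * real d * ln (2 * (20 * real d * ln (real d) + 1) + 1)"
      using m by (intro mult_left_mono ln_mono) auto
    also note elim(1)
    also have "20 * real d * ln (real d) / 5 \<le> real (m d) / 5"
      using m by simp
    finally have "box_cover_bound d (2 ^ 2 ^ (d - 1) * m d)"
      by (intro box_cover_boundI net_size_condition)
    then have "box_cover_number d \<le> 2 ^ 2 ^ (d - 1) * m d"
      unfolding box_cover_number_def by (rule Least_le)
    then have "real (box_cover_number d) \<le> 2 ^ 2 ^ (d - 1) * real (m d)"
      by (metis of_nat_le_iff of_nat_mult of_nat_numeral of_nat_power)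
    also have "\<dots> \<le> 2 ^ 2 ^ (d - 1) * (40 * (real d * ln (real d)))"
      using m elim(2) by (intro mult_left_mono) auto
    finally show ?case by (simp add: mult_ac)
  qed
  then show "(\<lambda>d. real (box_cover_number d)) \<in> O(\<lambda>d. 2 ^ (2 ^ (d - 1)) * real d * ln (real d))"
    by (intro bigoI[of _ 40]) (auto elim!: eventually_mono)
qed

end
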